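(* Let $\mathbf h=(h_1,h_1,\ldots,h_m,h_m)$ and $\mathbf k=(k_1,k_1,\ldots,k_n,k_n)$ be sequences of positive integers, of lengths $2m$ and $2n$ respectively, with $h_1+\cdots+h_m=k_1+\cdots+k_n$. There exists a NASM$(2m,2n;2\mathbf h,2\mathbf k)$ if and only if $$\sum_{i=1}^{m}2\min(2h_i,u)\ \ge\ \sum_{j=1}^{u}\kappa'_j\qquad\text{for every }1\le u\le 2n,$$ where $(\kappa'_1,\ldots,\kappa'_{2n})$ is the decreasing (nonincreasing) reordering of $2\mathbf k=(2k_1,2k_1,\ldots,2k_n,2k_n)$.
   Context: An $M\times N$ matrix with entries from $\{0,1,-1\}$ is a near alternating sign matrix (NASM) if the nonzero entries of each row (read left to right) and of each column (read top to bottom) alternate in sign. For sequences $\boldsymbol\eta=(\eta_1,\dots,\eta_M)$ and $\boldsymbol\kappa=(\kappa_1,\dots,\kappa_N)$, a NASM$(M,N;\boldsymbol\eta,\boldsymbol\kappa)$ is an $M\times N$ NASM whose $i$-th row has exactly $\eta_i$ nonzero entries and whose $j$-th column has exactly $\kappa_j$ nonzero entries, for all $i,j$. Here $2\mathbf h$ denotes the sequence obtained by doubling each term of $\mathbf h$. *)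

theory Defs
  imports "Jordan_Normal_Form.Matrix"
begin

definition alternates_in_sign :: "int list \<Rightarrow> bool" where
  "alternates_in_sign xs \<longleftrightarrow>
     successively (\<lambda>x y. sgn x \<noteq> sgn y) (filter (\<lambda>x. x \<noteq> 0) xs)"

definition nonzero_count :: "int list \<Rightarrow> nat" where
  "nonzero_count xs = length (filter (\<lambda>x. x \<noteq> 0) xs)"

definition is_nasm :: "nat \<Rightarrow> nat \<Rightarrow> int mat \<Rightarrow> bool" where
  "is_nasm M N A \<longleftrightarrow>
     A \<in> carrier_mat M N \<and>
     elements_mat A \<subseteq> {0, 1, -1} \<and>
     (\<forall>i<M. alternates_in_sign (list_of_vec (row A i))) \<and>
     (\<forall>j<N. alternates_in_sign (list_of_vec (col A j)))"

definition is_nasm_with ::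
    "nat \<Rightarrow> nat \<Rightarrow> nat list \<Rightarrow> nat list \<Rightarrow> int mat \<Rightarrow> bool" where
  "is_nasm_with M N \<eta> \<kappa> A \<longleftrightarrow>
     is_nasm M N A \<and> length \<eta> = M \<and> length \<kappa> = N \<and>
     (\<forall>i<M. nonzero_count (list_of_vec (row A i)) = \<eta> ! i) \<and>
     (\<forall>j<N. nonzero_count (list_of_vec (col A j)) = \<kappa> ! j)"

text \<open>From \<open>[x\<^sub>1, \<dots>, x\<^sub>r]\<close> to \<open>[x\<^sub>1, x\<^sub>1, \<dots>, x\<^sub>r, x\<^sub>r]\<close>.\<close>

definition repeat_each :: "'a list \<Rightarrow> 'a list" where
  "repeat_each xs = concat (map (\<lambda>x. [x, x]) xs)"

definition double_terms :: "nat list \<Rightarrow> nat list" where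
  "double_terms xs = map (\<lambda>x. 2 * x) xs"

definition nonincreasing_reordering :: "nat list \<Rightarrow> nat list" where
  "nonincreasing_reordering xs = rev (sort xs)"

end

theory Submission
  imports Defs "HOL-Combinatorics.List_Permutation"
begin

text \<open>
  Necessity is double counting: \<open>u\<close> columns of the support meet a row with \<open>r\<close> nonzero entries at
  most \<open>min r u\<close> times. For sufficiency, the hypothesis at the even value \<open>u = 2 * v\<close> is four times
  the \<open>v\<close>-th Gale--Ryser condition for \<open>h\<close> and \<open>k\<close>; so there is an \<open>m\<close> by \<open>n\<close> zero-one matrix with
  row sums \<open>h\<close> and column sums \<open>k\<close>, and replacing each of its ones by the block with rows
  \<open>(1, -1)\<close> and \<open>(-1, 1)\<close> gives the required matrix. The Gale--Ryser theorem itself is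
  proved by augmenting paths: as long as some column has too many ones, one of them can be
  transported, by exchanges within rows, to a column having too few.
\<close>

section \<open>The Gale--Ryser theorem\<close>

lemma sum_card_swap:
  assumes "finite A" "finite J"
  shows "(\<Sum>j\<in>J. card {i\<in>A. M i j}) = (\<Sum>i\<in>A. card {j\<in>J. M i j})"
proof -
  have "(\<Sum>j\<in>J. card {i\<in>A. M i j}) = (\<Sum>j\<in>J. \<Sum>i\<in>A. if M i j then 1 else 0)"
    using assms by (simp add: sum.If_cases Int_def)
  also have "\<dots> = (\<Sum>i\<in>A. \<Sum>j\<in>J. if M i j then 1 else 0)"
    by (rule sum.swap)
  also have "\<dots> = (\<Sum>i\<in>A. card {j\<in>J. M i j})"
    using assms by (simp add: sum.If_cases Int_def)
  finally show ?thesis .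
qed

lemma sum_column_card_le:
  assumes "finite A" "finite B" "J \<subseteq> B"
  shows "(\<Sum>j\<in>J. card {i\<in>A. M i j}) \<le> (\<Sum>i\<in>A. min (card {j\<in>B. M i j}) (card J))"
proof -
  have J: "finite J"
    using assms finite_subset by blast
  have "card {j\<in>J. M i j} \<le> min (card {j\<in>B. M i j}) (card J)" for i
    using assms J by (auto intro!: card_mono)
  then show ?thesis
    using sum_card_swap[OF assms(1) J] by (simp add: sum_mono)
qed

text \<open>The arcs of an auxiliary digraph on the columns: some row can shift a one along the arc
  and keep its row sum.\<close>

definition exchangeable :: "'a set \<Rightarrow> 'b set \<Rightarrow> ('a \<Rightarrow> 'b \<Rightarrow> bool) \<Rightarrow> 'b \<Rightarrow> 'b \<Rightarrow> bool" where
  "exchangeable A B M j j' \<longleftrightarrow> j \<in> B \<and> j' \<in> B \<and> (\<exists>i\<in>A. M i j \<and> \<not> M i j')"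

lemma card_row_exchange:
  assumes "finite B" "a \<in> B" "b \<in> B" "M i a" "\<not> M i b"
  shows "card {j\<in>B. (M(i := (M i)(a := False, b := True))) r j} = card {j\<in>B. M r j}"
proof (cases "r = i")
  case True
  have "a \<noteq> b"
    using assms by auto
  then have "{j\<in>B. (M(i := (M i)(a := False, b := True))) i j} = insert b ({j\<in>B. M i j} - {a})"
    using assms by auto
  then show ?thesis
    using True assms card_Suc_Diff1[of "{j\<in>B. M i j}" a] by simp
qed simp

text \<open>The corrections are added on both sides, so that no truncated subtraction occurs and
  successive exchanges along a path compose by cancellation.\<close>

lemma card_column_exchange:
  assumes "finite A" "i \<in> A" "M i a" "\<not> M i b"
  shows "card {r\<in>A. (M(i := (M i)(a := False, b := True))) r j} + of_bool (j = a)
    = card {r\<in>A. M r j} + of_bool (j = b)"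
proof -
  let ?M' = "M(i := (M i)(a := False, b := True))"
  have ne: "a \<noteq> b"
    using assms by auto
  consider "j = a" | "j = b" | "j \<noteq> a" "j \<noteq> b"
    by blast
  then show ?thesis
  proof cases
    case 1
    then have "{r\<in>A. ?M' r j} = {r\<in>A. M r j} - {i}"
      using ne by auto
    moreover have "i \<in> {r\<in>A. M r j}"
      using 1 assms by simp
    ultimately show ?thesis
      using 1 ne assms(1) card_Suc_Diff1[of "{r\<in>A. M r j}" i] by simp
  next
    case 2
    then have "{r\<in>A. ?M' r j} = insert i {r\<in>A. M r j}"
      using assms by auto
    then show ?thesis
      using 2 ne assms by simp
  next
    case 3
    then have "{r\<in>A. ?M' r j} = {r\<in>A. M r j}"
      by auto
    then show ?thesis
      using 3 by simp
  qed
qed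

text \<open>Carrying out one exchange may destroy later arcs of the path. Induction on the length
  avoids this: either the row used first allows a shortcut, or it is the witness of no later arc,
  and the rest of the path survives the exchange.\<close>

lemma transport_one:
  assumes "finite A" "finite B"
    and "p 0 \<noteq> p n" and "\<forall>l<n. exchangeable A B M (p l) (p (Suc l))"
  shows "\<exists>M'. (\<forall>i\<in>A. card {j\<in>B. M' i j} = card {j\<in>B. M i j}) \<and>
    (\<forall>j. card {i\<in>A. M' i j} + of_bool (j = p 0) = card {i\<in>A. M i j} + of_bool (j = p n))"
  using assms(3,4)
proof (induction n arbitrary: M p rule: less_induct)
  case (less n)
  have "n \<noteq> 0"
    using less.prems(1) by (cases n) auto
  then have "exchangeable A B M (p 0) (p (Suc 0))"
    using less.prems(2) by blast
  then obtain i where i: "i \<in> A" "M i (p 0)" "\<not> M i (p (Suc 0))"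
    and B: "p 0 \<in> B" "p (Suc 0) \<in> B"
    unfolding exchangeable_def by blast
  show ?case
  proof (cases "\<exists>l. 0 < l \<and> l < n \<and> \<not> M i (p (Suc l))")
    case True
    then obtain l where l: "0 < l" "l < n" "\<not> M i (p (Suc l))"
      by blast
    \<comment> \<open>Row \<open>i\<close> exchanges \<open>p 0\<close> with \<open>p (Suc l)\<close> directly, so the path can be shortened.\<close>
    define q where "q t = (if t = 0 then p 0 else p (t + l))" for t
    have "exchangeable A B M (q t) (q (Suc t))" if "t < n - l" for t
    proof (cases t)
      case 0
      have "p (Suc l) \<in> B"
        using less.prems(2) l unfolding exchangeable_def by blast
      then show ?thesis
        using i l B unfolding exchangeable_def q_def 0 by auto
    next
      case (Suc t')
      then show ?thesis
        using less.prems(2)[rule_format, of "t + l"] that by (simp add: q_def)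
    qed
    moreover have "q 0 = p 0" "q (n - l) = p n"
      using l by (auto simp: q_def)
    ultimately show ?thesis
      using less.IH[of "n - l" q M] less.prems(1) l by simp
  next
    case False
    then have full: "M i (p (Suc l))" if "0 < l" "l < n" for l
      using that by blast
    define M1 where "M1 = M(i := (M i)(p 0 := False, p (Suc 0) := True))"
    have row: "card {j\<in>B. M1 r j} = card {j\<in>B. M r j}" for r
      unfolding M1_def using assms(2) B i by (intro card_row_exchange) auto
    have col: "card {r\<in>A. M1 r j} + of_bool (j = p 0)
        = card {r\<in>A. M r j} + of_bool (j = p (Suc 0))" for j
      unfolding M1_def using assms(1) i by (intro card_column_exchange) auto
    show ?thesis
    \<comment> \<open>The induction hypothesis asks for distinct ends; if they coincide, the single
      exchange is already enough.\<close>
    proof (cases "p (Suc 0) = p n")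
      case True
      then show ?thesis
        using row col by (intro exI[of _ M1]) auto
    next
      case False
      have "exchangeable A B M1 (p (Suc l)) (p (Suc (Suc l)))" if "l < n - 1" for l
      proof -
        have l: "Suc l < n"
          using that by simp
        then have "exchangeable A B M (p (Suc l)) (p (Suc (Suc l)))"
          using less.prems(2) by simp
        then obtain r where r: "r \<in> A" "M r (p (Suc l))" "\<not> M r (p (Suc (Suc l)))"
          and inB: "p (Suc l) \<in> B" "p (Suc (Suc l)) \<in> B"
          unfolding exchangeable_def by blast
        \<comment> \<open>Row \<open>i\<close> has ones in all columns from \<open>p 2\<close> to
          \<open>p n\<close>, whereas the witness of a later arc has a zero at its head.\<close>
        have "r \<noteq> i"
          using full[of "Suc l"] r l by auto
        then have "M1 r = M r"
          by (simp add: M1_def)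
        then show ?thesis
          using r inB unfolding exchangeable_def by metis
      qed
      moreover have "Suc (n - 1) = n"
        using \<open>n \<noteq> 0\<close> by simp
      ultimately obtain M' where
        M': "\<forall>r\<in>A. card {j\<in>B. M' r j} = card {j\<in>B. M1 r j}"
          "\<forall>j. card {r\<in>A. M' r j} + of_bool (j = p (Suc 0))
            = card {r\<in>A. M1 r j} + of_bool (j = p n)"
        using less.IH[of "n - 1" "\<lambda>t. p (Suc t)" M1] False \<open>n \<noteq> 0\<close> by auto
      have "card {r\<in>A. M' r j} + of_bool (j = p 0) = card {r\<in>A. M r j} + of_bool (j = p n)" for j
        using M'(2)[rule_format, of j] col[of j] by linarith
      then show ?thesis
        using M'(1) row by (intro exI[of _ M']) simp
    qed
  qed
qed

text \<open>Dominance over all column sets, instead of prefixes of a sorted sequence, can be applied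
  directly to the complement of a reachable set. The proof starts from any matrix with the right row
  sums and lowers its column excess.\<close>

theorem Gale_Ryser:
  fixes h :: "'a \<Rightarrow> nat" and k :: "'b \<Rightarrow> nat"
  assumes fin: "finite A" "finite B"
    and total: "(\<Sum>i\<in>A. h i) = (\<Sum>j\<in>B. k j)"
    and dom: "\<And>J. J \<subseteq> B \<Longrightarrow> (\<Sum>j\<in>J. k j) \<le> (\<Sum>i\<in>A. min (h i) (card J))"
  shows "\<exists>M. (\<forall>i\<in>A. card {j\<in>B. M i j} = h i) \<and> (\<forall>j\<in>B. card {i\<in>A. M i j} = k j)"
proof -
  have improve: "\<exists>M'. (\<forall>i\<in>A. card {j\<in>B. M' i j} = h i) \<and> (\<forall>j\<in>B. card {i\<in>A. M' i j} = k j)"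
    if "\<forall>i\<in>A. card {j\<in>B. M i j} = h i" for M
    using that
  \<comment> \<open>Truncated subtraction makes this the total excess: columns with too few ones
    contribute 0.\<close>
  proof (induction "\<Sum>j\<in>B. card {i\<in>A. M i j} - k j" arbitrary: M rule: less_induct)
    case less
    let ?c = "\<lambda>j. card {i\<in>A. M i j}"
    have sum_c: "(\<Sum>j\<in>B. ?c j) = (\<Sum>j\<in>B. k j)"
      using less.prems total sum_card_swap[OF fin, of M] by simp
    show ?case
    proof (cases "\<exists>s\<in>B. k s < ?c s")
      case False
      then have le: "\<forall>j\<in>B. ?c j \<le> k j"
        by (simp add: not_less)
      have "?c j = k j" if "j \<in> B" for j
      proof (rule ccontr)
        assume "?c j \<noteq> k j"
        then have "?c j < k j"
          using le that by (simp add: le_neq_implies_less)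
        then have "(\<Sum>j\<in>B. ?c j) < (\<Sum>j\<in>B. k j)"
          using le that by (intro sum_strict_mono_ex1[OF fin(2)]) blast+
        then show False
          using sum_c by simp
      qed
      then show ?thesis
        using less.prems by blast
    next
      case True
      then obtain s where s: "s \<in> B" "k s < ?c s"
        by blast
      \<comment> \<open>The columns to which a one of \<open>s\<close> can be transported; one of
        them must have too few ones.\<close>
      define T where "T = {t\<in>B. (exchangeable A B M)\<^sup>*\<^sup>* s t}"
      have T: "T \<subseteq> B" "s \<in> T"
        using s by (auto simp: T_def)
      \<comment> \<open>A row meeting \<open>T\<close> is full outside \<open>T\<close>, so the columns outside \<open>T\<close> attain the bound of \<open>dom\<close>.\<close>
      have "\<exists>t\<in>T. ?c t < k t"
      proof (rule ccontr)
        assume "\<not> (\<exists>t\<in>T. ?c t < k t)"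
        then have "(\<Sum>j\<in>T. k j) < (\<Sum>j\<in>T. ?c j)"
          using T s fin finite_subset by (intro sum_strict_mono_ex1) (auto simp: not_less)
        moreover have "(\<Sum>j\<in>B - T. k j) \<le> (\<Sum>j\<in>B - T. ?c j)"
        proof -
          have "min (h i) (card (B - T)) \<le> card {j\<in>B - T. M i j}" if "i \<in> A" for i
          proof (cases "\<exists>t\<in>T. M i t")
            case True
            then obtain t where t: "t \<in> T" "M i t"
              by blast
            have "M i j" if "j \<in> B - T" for j
            proof (rule ccontr)
              assume "\<not> M i j"
              then have "exchangeable A B M t j"
                using t T that \<open>i \<in> A\<close> unfolding exchangeable_def by blast
              then have "j \<in> T"
                using t that unfolding T_def by (auto intro: rtranclp.rtrancl_into_rtrancl)
              then show False
                using that by blast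
            qed
            then have "{j\<in>B - T. M i j} = B - T"
              by blast
            then show ?thesis
              by simp
          next
            \<comment> \<open>A row that misses \<open>T\<close> has all its \<open>h i\<close> ones
              outside \<open>T\<close>.\<close>
            case False
            then have "{j\<in>B - T. M i j} = {j\<in>B. M i j}"
              by blast
            then show ?thesis
              using less.prems that by simp
          qed
          then have "(\<Sum>i\<in>A. min (h i) (card (B - T))) \<le> (\<Sum>i\<in>A. card {j\<in>B - T. M i j})"
            by (rule sum_mono)
          then show ?thesis
            using dom[of "B - T"] sum_card_swap[of A "B - T" M] fin by simp
        qed
        \<comment> \<open>Adding the estimates over \<open>T\<close> and \<open>B - T\<close> makes
          the total of \<open>k\<close> strictly smaller than that of \<open>?c\<close>.\<close>
        ultimately show False
          using sum_c sum.subset_diff[OF T(1) fin(2), of ?c] sum.subset_diff[OF T(1) fin(2), of k]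
          by simp
      qed
      then obtain t where t: "t \<in> B" "?c t < k t" "(exchangeable A B M)\<^sup>*\<^sup>* s t"
        unfolding T_def by blast
      obtain n where "(exchangeable A B M ^^ n) s t"
        using t(3) by (auto simp: rtranclp_power)
      then obtain p where p: "p 0 = s" "p n = t" "\<forall>l<n. exchangeable A B M (p l) (p (Suc l))"
        unfolding relpowp_fun_conv by blast
      have "s \<noteq> t"
        using s t by auto
      then obtain M' where M': "\<forall>i\<in>A. card {j\<in>B. M' i j} = card {j\<in>B. M i j}"
        "\<And>j. card {i\<in>A. M' i j} + of_bool (j = s) = ?c j + of_bool (j = t)"
        using transport_one[OF fin, of p n M] p by auto
      \<comment> \<open>Column \<open>s\<close> loses a unit of excess, while \<open>t\<close> had
        room for one more and still contributes 0.\<close>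
      have "(\<Sum>j\<in>B. card {i\<in>A. M' i j} - k j) < (\<Sum>j\<in>B. ?c j - k j)"
      proof (rule sum_strict_mono_ex1[OF fin(2)])
        show "\<forall>j\<in>B. card {i\<in>A. M' i j} - k j \<le> ?c j - k j"
        proof
          fix j
          show "card {i\<in>A. M' i j} - k j \<le> ?c j - k j"
            using M'(2)[of j] t(2) by (cases "j = t"; cases "j = s") auto
        qed
        show "\<exists>j\<in>B. card {i\<in>A. M' i j} - k j < ?c j - k j"
          using M'(2)[of s] s \<open>s \<noteq> t\<close> by (intro bexI[of _ s]) auto
      qed
      then show ?thesis
        using less.hyps[of M'] less.prems M'(1) by simp
    qed
  qed
  \<comment> \<open>A starting matrix exists once every row sum fits into \<open>B\<close>; this is
    dominance at \<open>J = B\<close> together with the equality of totals.\<close>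
  have "h i \<le> card B" if "i \<in> A" for i
  proof (rule ccontr)
    assume "\<not> h i \<le> card B"
    then have "(\<Sum>i\<in>A. min (h i) (card B)) < (\<Sum>i\<in>A. h i)"
      using that fin by (intro sum_strict_mono_ex1) (auto intro!: bexI[of _ i])
    then show False
      using dom[of B] total by simp
  qed
  then have "\<forall>i\<in>A. \<exists>S. S \<subseteq> B \<and> card S = h i"
    by (meson obtain_subset_with_card_n)
  then obtain S where S: "\<And>i. i \<in> A \<Longrightarrow> S i \<subseteq> B \<and> card (S i) = h i"
    by metis
  have "{j\<in>B. j \<in> S i} = S i" if "i \<in> A" for i
    using S[OF that] by blast
  then show ?thesis
    using improve[of "\<lambda>i j. j \<in> S i"] S by simp
qed

section \<open>Reorderings and doubled lists\<close>

lemma nonincreasing_reordering_permutation: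
  obtains p where "bij_betw p {..<length xs} {..<length xs}"
    "\<And>j. j < length xs \<Longrightarrow> nonincreasing_reordering xs ! j = xs ! p j"
proof -
  have "mset (nonincreasing_reordering xs) = mset xs"
    by (simp add: nonincreasing_reordering_def)
  then show thesis
    using permutation_Ex_bij[of "nonincreasing_reordering xs" xs] that
    by (metis mset_eq_length)
qed

text \<open>The largest element of \<open>J\<close> is at least \<open>card J - 1\<close>, so its
  term is at most the last term on the right; remove both and induct.\<close>

lemma sum_subset_le_sum_initial:
  fixes s :: "nat \<Rightarrow> nat"
  assumes "J \<subseteq> {..<N}" and anti: "\<And>a b. a \<le> b \<Longrightarrow> b < N \<Longrightarrow> s b \<le> s a"
  shows "(\<Sum>j\<in>J. s j) \<le> (\<Sum>j<card J. s j)"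
  using assms(1)
proof (induction "card J" arbitrary: J)
  case 0
  then have "J = {}"
    using finite_subset[of J "{..<N}"] by auto
  then show ?case
    by simp
next
  case (Suc c)
  have fin: "finite J"
    using Suc.prems finite_subset by blast
  have ne: "J \<noteq> {}"
    using Suc.hyps(2) by auto
  define x where "x = Max J"
  have x: "x \<in> J"
    using fin ne by (simp add: x_def)
  have "J \<subseteq> {..x}"
    using fin by (auto simp: x_def)
  then have "card J \<le> Suc x"
    by (metis card_atMost card_mono finite_atMost)
  then have "s x \<le> s c"
    using anti[of c x] x Suc by auto
  moreover have "(\<Sum>j\<in>J - {x}. s j) \<le> (\<Sum>j<c. s j)"
    using Suc.hyps(1)[of "J - {x}"] Suc.prems card_Suc_Diff1[OF fin x]
    by (auto simp flip: Suc.hyps(2))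
  ultimately show ?case
    using sum.remove[OF fin x, of s] Suc.hyps(2)[symmetric] by simp
qed

text \<open>This links the prefix sums in the hypothesis on \<open>u\<close> to the arbitrary column
  sets in \<open>Gale_Ryser\<close>.\<close>

lemma sum_subset_le_nonincreasing_reordering:
  assumes "J \<subseteq> {..<length xs}"
  shows "(\<Sum>j\<in>J. xs ! j) \<le> (\<Sum>j<card J. nonincreasing_reordering xs ! j)"
proof -
  obtain p where p: "bij_betw p {..<length xs} {..<length xs}"
    "\<And>j. j < length xs \<Longrightarrow> nonincreasing_reordering xs ! j = xs ! p j"
    using nonincreasing_reordering_permutation[of xs] by blast
  \<comment> \<open>The positions that the entries indexed by \<open>J\<close> occupy after
    sorting.\<close>
  define I where "I = {i. i < length xs \<and> p i \<in> J}"
  have bij: "bij_betw p I J"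
    unfolding bij_betw_def
  proof
    show "inj_on p I"
      using p(1) by (rule inj_on_subset[OF bij_betw_imp_inj_on]) (auto simp: I_def)
    have "J \<subseteq> p ` {..<length xs}"
      using p(1) assms by (simp add: bij_betw_def)
    then show "p ` I = J"
      by (auto simp: I_def)
  qed
  have "nonincreasing_reordering xs ! b \<le> nonincreasing_reordering xs ! a"
    if "a \<le> b" "b < length xs" for a b
    using that by (auto simp: nonincreasing_reordering_def rev_nth intro!: sorted_nth_mono)
  then have "(\<Sum>i\<in>I. nonincreasing_reordering xs ! i) \<le> (\<Sum>i<card I. nonincreasing_reordering xs ! i)"
    by (intro sum_subset_le_sum_initial[of _ "length xs"]) (auto simp: I_def)
  moreover have "(\<Sum>i\<in>I. nonincreasing_reordering xs ! i) = (\<Sum>i\<in>I. xs ! p i)"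
    using p(2) by (auto simp: I_def)
  ultimately show ?thesis
    using sum.reindex_bij_betw[OF bij, of "(!) xs"] bij_betw_same_card[OF bij] by simp
qed

lemma length_double_repeat [simp]: "length (double_terms (repeat_each xs)) = 2 * length xs"
  by (induction xs) (auto simp: double_terms_def repeat_each_def)

lemma nth_double_repeat:
  "i < 2 * length xs \<Longrightarrow> double_terms (repeat_each xs) ! i = 2 * xs ! (i div 2)"
proof (induction xs arbitrary: i)
  case (Cons x xs)
  consider "i = 0" | "i = 1" | i' where "i = Suc (Suc i')"
    by (metis One_nat_def not0_implies_Suc)
  then show ?case
    using Cons by cases (auto simp: double_terms_def repeat_each_def)
qed simp

lemma sum_div_2:
  fixes f :: "nat \<Rightarrow> nat"
  shows "(\<Sum>i<2 * m. f (i div 2)) = (\<Sum>i<m. 2 * f i)"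
  by (induction m) auto

section \<open>Inflating a zero-one matrix\<close>

text \<open>Blocks begin at even indices, so this checkerboard of signs gives every block the same
  pattern.\<close>

definition inflate :: "nat \<Rightarrow> nat \<Rightarrow> (nat \<Rightarrow> nat \<Rightarrow> bool) \<Rightarrow> int mat" where
  "inflate m n M = mat (2 * m) (2 * n)
     (\<lambda>(i, j). if M (i div 2) (j div 2) then (-1) ^ (i + j) else 0)"

text \<open>Each block met by the line contributes two adjacent entries, the first at an even
  position; hence all pairs have the same sign order. Here \<open>s\<close> is the sign at position
  0.\<close>

lemma filter_inflated_line:
  fixes s :: int
  assumes "s \<noteq> 0"
  shows "filter (\<lambda>x. x \<noteq> 0) (map (\<lambda>j. if P (j div 2) then s * (-1) ^ j else 0) [0..<2 * n])
    = concat (replicate (card {j\<in>{..<n}. P j}) [s, -s])"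
proof (induction n)
  case (Suc n)
  have *: "{j\<in>{..<Suc n}. P j} = (if P n then insert n {j\<in>{..<n}. P j} else {j\<in>{..<n}. P j})"
    by (auto simp: less_Suc_eq)
  have "concat (replicate (Suc c) [s, -s]) = concat (replicate c [s, -s]) @ [s, -s]" for c
    by (induction c) auto
  then show ?case
    using Suc assms * by auto
qed simp

text \<open>Stated for an abstract line so as to serve rows, with \<open>s = (-1) ^ i\<close>, and
  columns, with \<open>s = (-1) ^ j\<close>.\<close>

lemma inflated_line:
  fixes s :: int
  assumes "s \<noteq> 0"
    and xs: "xs = map (\<lambda>j. if P (j div 2) then s * (-1) ^ j else 0) [0..<2 * n]"
  shows "alternates_in_sign xs" and "nonzero_count xs = 2 * card {j\<in>{..<n}. P j}"
proof -
  have "successively (\<lambda>x y. sgn x \<noteq> sgn y) (concat (replicate c [s, -s]))" for c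
  proof (induction c)
    case (Suc c)
    \<comment> \<open>Splitting on \<open>c\<close> exposes the junction where \<open>-s\<close>
      meets the \<open>s\<close> of the next pair.\<close>
    then show ?case
      using assms(1) by (cases c) (auto simp: sgn_if)
  qed simp
  then show "alternates_in_sign xs"
    unfolding alternates_in_sign_def xs filter_inflated_line[OF assms(1)] .
  have "length (concat (replicate c [s, -s])) = 2 * c" for c
    by (induction c) auto
  then show "nonzero_count xs = 2 * card {j\<in>{..<n}. P j}"
    unfolding nonzero_count_def xs filter_inflated_line[OF assms(1)] .
qed

lemma list_of_vec_eq_map: "list_of_vec v = map (\<lambda>i. v $ i) [0..<dim_vec v]"
  by (intro nth_equalityI) (auto simp: list_of_vec_index)

lemma row_inflate:
  assumes "i < 2 * m"
  shows "list_of_vec (row (inflate m n M) i)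
    = map (\<lambda>j. if M (i div 2) (j div 2) then (-1) ^ i * (-1) ^ j else 0) [0..<2 * n]"
  using assms unfolding list_of_vec_eq_map by (auto simp: inflate_def power_add)

lemma col_inflate:
  assumes "j < 2 * n"
  shows "list_of_vec (col (inflate m n M) j)
    = map (\<lambda>i. if M (i div 2) (j div 2) then (-1) ^ j * (-1) ^ i else 0) [0..<2 * m]"
  using assms unfolding list_of_vec_eq_map by (auto simp: inflate_def power_add)

lemma is_nasm_with_inflate:
  assumes "length h = m" "length k = n"
    and "\<forall>i\<in>{..<m}. card {j\<in>{..<n}. M i j} = h ! i"
    and "\<forall>j\<in>{..<n}. card {i\<in>{..<m}. M i j} = k ! j"
  shows "is_nasm_with (2 * m) (2 * n) (double_terms (repeat_each h)) (double_terms (repeat_each k))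
    (inflate m n M)"
proof -
  have "elements_mat (inflate m n M) \<subseteq> {0, 1, -1}"
    by (auto simp: elements_mat_def inflate_def minus_one_power_iff)
  moreover have "inflate m n M \<in> carrier_mat (2 * m) (2 * n)"
    by (simp add: inflate_def)
  moreover have "alternates_in_sign (list_of_vec (row (inflate m n M) i))"
    "nonzero_count (list_of_vec (row (inflate m n M) i)) = double_terms (repeat_each h) ! i"
    if "i < 2 * m" for i
    using inflated_line[OF _ row_inflate[OF that, of n M]] that assms
    by (auto simp: nth_double_repeat)
  moreover have "alternates_in_sign (list_of_vec (col (inflate m n M) j))"
    "nonzero_count (list_of_vec (col (inflate m n M) j)) = double_terms (repeat_each k) ! j"
    if "j < 2 * n" for j
    using inflated_line[OF _ col_inflate[OF that, of m M]] that assms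
    by (auto simp: nth_double_repeat)
  ultimately show ?thesis
    using assms by (simp add: is_nasm_with_def is_nasm_def)
qed

section \<open>Necessity and sufficiency of the dominance condition\<close>

lemma nonzero_count_list_of_vec:
  "nonzero_count (list_of_vec v) = card {i\<in>{..<dim_vec v}. v $ i \<noteq> 0}"
  unfolding nonzero_count_def length_filter_conv_card
  by (intro arg_cong[where f = card]) (auto simp: list_of_vec_index)

lemma nasm_imp_dominance:
  assumes "length h = m" "length k = n"
    and "is_nasm_with (2 * m) (2 * n)
      (double_terms (repeat_each h)) (double_terms (repeat_each k)) A"
    and "u \<le> 2 * n"
  shows "(\<Sum>j<u. nonincreasing_reordering (double_terms (repeat_each k)) ! j)
    \<le> (\<Sum>i<m. 2 * min (2 * h ! i) u)"
proof -
  let ?H = "double_terms (repeat_each h)" and ?K = "double_terms (repeat_each k)"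
  have A: "A \<in> carrier_mat (2 * m) (2 * n)"
    using assms(3) by (simp add: is_nasm_with_def is_nasm_def)
  have row: "nonzero_count (list_of_vec (row A i)) = ?H ! i" if "i < 2 * m" for i
    using assms(3) that by (simp add: is_nasm_with_def)
  have col: "nonzero_count (list_of_vec (col A j)) = ?K ! j" if "j < 2 * n" for j
    using assms(3) that by (simp add: is_nasm_with_def)
  have row': "card {j\<in>{..<2 * n}. A $$ (i, j) \<noteq> 0} = 2 * h ! (i div 2)" if "i < 2 * m" for i
  proof -
    have "{j\<in>{..<2 * n}. A $$ (i, j) \<noteq> 0} = {j\<in>{..<dim_vec (row A i)}. row A i $ j \<noteq> 0}"
      using A that by auto
    then show ?thesis
      using row[OF that] that assms(1) by (simp add: nonzero_count_list_of_vec nth_double_repeat)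
  qed
  have col': "card {i\<in>{..<2 * m}. A $$ (i, j) \<noteq> 0} = ?K ! j" if "j < 2 * n" for j
  proof -
    have "{i\<in>{..<2 * m}. A $$ (i, j) \<noteq> 0} = {i\<in>{..<dim_vec (col A j)}. col A j $ i \<noteq> 0}"
      using A that by auto
    then show ?thesis
      using col[OF that] by (simp add: nonzero_count_list_of_vec)
  qed
  obtain p where p: "bij_betw p {..<2 * n} {..<2 * n}"
    "\<And>j. j < 2 * n \<Longrightarrow> nonincreasing_reordering ?K ! j = ?K ! p j"
    using nonincreasing_reordering_permutation[of ?K] assms(2) by auto
  \<comment> \<open>The columns of \<open>A\<close> holding the \<open>u\<close> largest column
    counts, found through the sorting permutation.\<close>
  define J where "J = p ` {..<u}"
  have inj: "inj_on p {..<u}"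
    using p(1) assms(4) by (auto simp: bij_betw_def intro: inj_on_subset)
  have J: "J \<subseteq> {..<2 * n}"
    using p(1) assms(4) by (auto simp: J_def bij_betw_def)
  have "(\<Sum>j<u. nonincreasing_reordering ?K ! j) = (\<Sum>j<u. ?K ! p j)"
    using p(2) assms(4) by (intro sum.cong) auto
  also have "\<dots> = (\<Sum>j\<in>J. ?K ! j)"
    unfolding J_def using sum.reindex[OF inj, of "(!) ?K"] by simp
  also have "\<dots> = (\<Sum>j\<in>J. card {i\<in>{..<2 * m}. A $$ (i, j) \<noteq> 0})"
    using J col' by (intro sum.cong) auto
  also have "\<dots> \<le> (\<Sum>i<2 * m. min (card {j\<in>{..<2 * n}. A $$ (i, j) \<noteq> 0}) (card J))"
    using J by (intro sum_column_card_le) auto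
  also have "\<dots> = (\<Sum>i<2 * m. min (2 * h ! (i div 2)) u)"
    using row' inj by (intro sum.cong) (auto simp: J_def card_image)
  \<comment> \<open>Rows \<open>2 * i\<close> and \<open>2 * i + 1\<close> have the same count,
    whence the outer factor 2.\<close>
  also have "\<dots> = (\<Sum>i<m. 2 * min (2 * h ! i) u)"
    by (rule sum_div_2)
  finally show ?thesis .
qed

lemma dominance_imp_nasm:
  assumes "length h = m" "length k = n" "(\<Sum>i<m. h ! i) = (\<Sum>j<n. k ! j)"
    and "\<And>u. u \<in> {1..2 * n} \<Longrightarrow> (\<Sum>j<u. nonincreasing_reordering (double_terms (repeat_each k)) ! j)
    \<le> (\<Sum>i<m. 2 * min (2 * h ! i) u)"
  shows "\<exists>A. is_nasm_with (2 * m) (2 * n)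
    (double_terms (repeat_each h)) (double_terms (repeat_each k)) A"
proof -
  let ?K = "double_terms (repeat_each k)"
  have "(\<Sum>j\<in>J. k ! j) \<le> (\<Sum>i<m. min (h ! i) (card J))" if J: "J \<subseteq> {..<n}" for J
  \<comment> \<open>The hypothesis begins at \<open>u = 1\<close>, so the empty set is treated
    apart.\<close>
  proof (cases "J = {}")
    case False
    have fin: "finite J"
      using J finite_subset by blast
    \<comment> \<open>Both copies of every column in \<open>J\<close>; \<open>card D\<close> is the
      even \<open>u\<close> at which the hypothesis is used.\<close>
    define D where "D = (\<lambda>j. 2 * j) ` J \<union> (\<lambda>j. 2 * j + 1) ` J"
    have disj: "(\<lambda>j. 2 * j) ` J \<inter> (\<lambda>j. 2 * j + 1) ` J = {}"
      by (auto dest: arg_cong[where f = even])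
    have inj: "inj_on (\<lambda>j::nat. 2 * j) J" "inj_on (\<lambda>j::nat. 2 * j + 1) J"
      by (auto simp: inj_on_def)
    have card_D: "card D = 2 * card J"
      unfolding D_def using fin disj inj by (simp add: card_Un_disjoint card_image)
    have D: "D \<subseteq> {..<2 * n}"
      using J by (auto simp: D_def)
    have "card J \<noteq> 0" "card J \<le> n"
      using False fin J card_mono[OF _ J] by auto
    then have u: "card D \<in> {1..2 * n}"
      using card_D by simp
    \<comment> \<open>The factor 4 comes from two copies of each column, each with prescribed count
      \<open>2 * k ! j\<close>.\<close>
    have "4 * (\<Sum>j\<in>J. k ! j) = (\<Sum>j\<in>J. 2 * k ! ((2 * j) div 2)) + (\<Sum>j\<in>J. 2 * k ! ((2 * j + 1) div 2))"
      by (simp add: sum_distrib_left sum.distrib[symmetric])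
    also have "\<dots> = (\<Sum>j\<in>D. 2 * k ! (j div 2))"
      unfolding D_def using fin disj inj by (simp add: sum.union_disjoint sum.reindex)
    also have "\<dots> = (\<Sum>j\<in>D. ?K ! j)"
      using D assms(2) by (intro sum.cong) (auto simp: nth_double_repeat)
    also have "\<dots> \<le> (\<Sum>j<card D. nonincreasing_reordering ?K ! j)"
      using D assms(2) by (intro sum_subset_le_nonincreasing_reordering) simp
    also have "\<dots> \<le> (\<Sum>i<m. 2 * min (2 * h ! i) (card D))"
      using assms(4) u by blast
    \<comment> \<open>As \<open>card D\<close> is even, a factor 2 leaves the minimum and joins the
      one in front, matching the 4 on the left.\<close>
    also have "\<dots> = 4 * (\<Sum>i<m. min (h ! i) (card J))"
      unfolding sum_distrib_left card_D by (intro sum.cong) (auto simp: min_def)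
    finally show ?thesis
      by simp
  qed simp
  then obtain M where "\<forall>i\<in>{..<m}. card {j\<in>{..<n}. M i j} = h ! i"
    "\<forall>j\<in>{..<n}. card {i\<in>{..<m}. M i j} = k ! j"
    using Gale_Ryser[of "{..<m}" "{..<n}" "(!) h" "(!) k"] assms(3) by auto
  then show ?thesis
    using is_nasm_with_inflate assms(1,2) by blast
qed

theorem theorem3p8:
  fixes m n :: nat and h k :: "nat list"
  assumes "length h = m" and "length k = n"
    and "\<forall>i<m. 0 < h ! i" and "\<forall>j<n. 0 < k ! j"
    and "(\<Sum>i<m. h ! i) = (\<Sum>j<n. k ! j)"
  shows "(\<exists>A. is_nasm_with (2 * m) (2 * n)
            (double_terms (repeat_each h)) (double_terms (repeat_each k)) A) \<longleftrightarrow>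
         (\<forall>u\<in>{1..2 * n}.
            (\<Sum>i<m. 2 * min (2 * h ! i) u) \<ge>
            (\<Sum>j<u. nonincreasing_reordering (double_terms (repeat_each k)) ! j))"
proof (intro iffI ballI)
  fix u
  assume "\<exists>A. is_nasm_with (2 * m) (2 * n)
      (double_terms (repeat_each h)) (double_terms (repeat_each k)) A" and "u \<in> {1..2 * n}"
  then show "(\<Sum>j<u. nonincreasing_reordering (double_terms (repeat_each k)) ! j)
      \<le> (\<Sum>i<m. 2 * min (2 * h ! i) u)"
    using nasm_imp_dominance[OF assms(1,2)] by fastforce
next
  assume "\<forall>u\<in>{1..2 * n}. (\<Sum>j<u. nonincreasing_reordering (double_terms (repeat_each k)) ! j)
      \<le> (\<Sum>i<m. 2 * min (2 * h ! i) u)"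
  then show "\<exists>A. is_nasm_with (2 * m) (2 * n)
      (double_terms (repeat_each h)) (double_terms (repeat_each k)) A"
    using dominance_imp_nasm[OF assms(1,2,5)] by blast
qed

end
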